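(* Assume that the solution set of the KKT system of the problem $\min_{x\in\mathcal X,\,y\in\mathcal Y}\{f(x)+g(y)\mid Ax+By=c\}$ is non-empty. Let $\{(x^k,y^k,z^k)\}$ be the sequence generated by the semi-proximal ADMM (sPADMM) described in the context, with $\tau\in(0,1]$. Let $(x^*,y^* )$ be an optimal solution of the problem and $z^*$ an optimal solution of its dual problem. Then, for all $K=1,2,3,\ldots$, one has $$-\|z^*\|\sqrt{\tfrac{C}{\tau\lambda K}}\;\le\; f(x^{K+1})+g(y^{K+1})-f(x^* )-g(y^* )\;\le\;\|z^*\|\sqrt{\tfrac{C}{\tau\lambda K}}+\frac{4C}{\sqrt K}+\frac{C}{K\sqrt\tau},$$ $$0\le\|Ax^{K+1}+By^{K+1}-c\|=\frac{1}{\tau\lambda}\|z^{K+1}-z^K\|\le\sqrt{\tfrac{C}{\tau\lambda K}},$$ where $C=\max\{C_1,C_2\}$ is a nonnegative constant with $$C_1:=\tfrac1\lambda\|z^1-z^*\|^2+\lambda\|B(y^1-y^* )\|^2+\|x^1-x^*\|_{\mathcal S}^2+\|y^1-y^*\|_{\mathcal T}^2+\|y^0-y^1\|_{\mathcal T}^2,$$ $$C_2:=\tfrac1m\Big(\tfrac{1}{\tau\lambda}\|z^1-z^*\|^2+\lambda\|B(y^1-y^* )\|^2+\|x^1-x^*\|_{\mathcal S}^2+\|y^1-y^*\|_{\mathcal T}^2\Big),$$ and $m:=2\tau\lambda t-\frac{\tau-2}{\tau}$ with $t:=\frac{\tau-1-\sqrt{\tau^2-\tau+1}}{2\tau^2\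lambda}$.
   Context: $\mathcal X,\mathcal Y,\mathcal Z$ are finite-dimensional real Hilbert spaces, each with an inner product $\langle\cdot,\cdot\rangle$ and induced norm $\|\cdot\|$; $f:\mathcal X\to(-\infty,\infty]$ and $g:\mathcal Y\to(-\infty,\infty]$ are closed proper convex functions; $A:\mathcal X\to\mathcal Z$, $B:\mathcal Y\to\mathcal Z$ are linear operators with adjoints $A^*,B^*$; $c\in\mathcal Z$. For a self-adjoint positive semidefinite operator $\mathcal S$, $\|x\|_{\mathcal S}:=\sqrt{\langle x,\mathcal Sx\rangle}$. KKT system: $(x^*,y^*,z^* )$ solves it if $Ax^*+By^*=c$, $0\in\partial f(x^* )-A^*z^*$, $0\in\partial g(y^* )-B^*z^*$. The dual problem is the Lagrangian dual associated with the Lagrangian $f(x)+g(y)-\langle Ax+By-c,z\rangle$. $\Sigma_f:\mathcal X\to\mathcal X$ and $\Sigma_g:\mathcal Y\to\mathcal Y$ are self-adjoint positive semidefinite operators such that for all $x,\hat x\in\mathrm{dom}(f)$, $w\in\partial f(x)$, $\hat w\in\partial f(\hat x)$: $f(x)\ge f(\hat x)+\langle\hat w,x-\hat x\rangle+\frac12\|x-\hat x\|_{\Sigma_f}^2$ and $\langle w-\hat w,x-\hat x\rangle\ge\|x-\hat x\|_{\Sigma_f}^2$; and likewise for $g$ with $\Sigma_g$. Augmented Lagrangian ($\lambda>0$): $\mathcal L_\lambda(x,y,z):=f(x)+g(y)-\langle Ax+By-c,z\rangle+\frac\lambda2\|Ax+By-c\|^2$. sPADMM: input $x^0\in\mathcal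 X$, $y^0\in\mathcal Y$, $z^0\in\mathcal Z$, $\lambda>0$, $\tau>0$, and self-adjoint linear operators $\mathcal S:\mathcal X\to\mathcal X$, $\mathcal T:\mathcal Y\to\mathcal Y$ with $\mathcal S\succeq0$, $\mathcal T\succeq0$, $\Sigma_f+\mathcal S+\lambda A^*A\succ0$, $\Sigma_g+\mathcal T+\lambda B^*B\succ0$. For $k=0,1,\ldots$: 1. $x^{k+1}:=\arg\min_x\ \mathcal L_\lambda(x,y^k,z^k)+\frac12\|x-x^k\|_{\mathcal S}^2$; 2. $y^{k+1}:=\arg\min_y\ \mathcal L_\lambda(x^{k+1},y,z^k)+\frac12\|y-y^k\|_{\mathcal T}^2$; 3. $z^{k+1}:=z^k-\tau\lambda(Ax^{k+1}+By^{k+1}-c)$. *)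

theory Defs
  imports "HOL-Analysis.Analysis"
begin

definition edom :: "('a \<Rightarrow> ereal) \<Rightarrow> 'a set" where
  "edom f = {x. f x < \<infinity>}"

definition ereal_epigraph :: "('a \<Rightarrow> ereal) \<Rightarrow> ('a \<times> real) set" where
  "ereal_epigraph f = {(x, r). f x \<le> ereal r}"

definition closed_proper_convex :: "('a::euclidean_space \<Rightarrow> ereal) \<Rightarrow> bool" where
  "closed_proper_convex f \<longleftrightarrow>
     (\<forall>x. f x \<noteq> -\<infinity>) \<and> edom f \<noteq> {} \<and>
     convex (ereal_epigraph f) \<and> closed (ereal_epigraph f)"

definition subdifferential :: "('a::euclidean_space \<Rightarrow> ereal) \<Rightarrow> 'a \<Rightarrow> 'a set" where
  "subdifferential f x = {w. \<forall>u. f u \<ge> f x + ereal (w \<bullet> (u - x))}"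

definition self_adjoint :: "('a::euclidean_space \<Rightarrow> 'a) \<Rightarrow> bool" where
  "self_adjoint S \<longleftrightarrow> linear S \<and> adjoint S = S"

definition pos_semidef :: "('a::euclidean_space \<Rightarrow> 'a) \<Rightarrow> bool" where
  "pos_semidef S \<longleftrightarrow> self_adjoint S \<and> (\<forall>x. x \<bullet> S x \<ge> 0)"

definition pos_def :: "('a::euclidean_space \<Rightarrow> 'a) \<Rightarrow> bool" where
  "pos_def S \<longleftrightarrow> self_adjoint S \<and> (\<forall>x. x \<noteq> 0 \<longrightarrow> x \<bullet> S x > 0)"

definition seminorm_op :: "('a::euclidean_space \<Rightarrow> 'a) \<Rightarrow> 'a \<Rightarrow> real" where
  "seminorm_op S x = sqrt (x \<bullet> S x)"

definition curvature_op :: "('a::euclidean_space \<Rightarrow> ereal) \<Rightarrow> ('a \<Rightarrow> 'a) \<Rightarrow> bool" where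
  "curvature_op f \<Sigma> \<longleftrightarrow> pos_semidef \<Sigma> \<and>
     (\<forall>x\<in>edom f. \<forall>x'\<in>edom f. \<forall>w\<in>subdifferential f x. \<forall>w'\<in>subdifferential f x'.
        f x \<ge> f x' + ereal (w' \<bullet> (x - x') + (seminorm_op \<Sigma> (x - x'))\<^sup>2 / 2) \<and>
        (w - w') \<bullet> (x - x') \<ge> (seminorm_op \<Sigma> (x - x'))\<^sup>2)"

definition kkt_solution ::
  "('a::euclidean_space \<Rightarrow> ereal) \<Rightarrow> ('b::euclidean_space \<Rightarrow> ereal) \<Rightarrow>
   ('a \<Rightarrow> 'c::euclidean_space) \<Rightarrow> ('b \<Rightarrow> 'c) \<Rightarrow> 'c \<Rightarrow> 'a \<Rightarrow> 'b \<Rightarrow> 'c \<Rightarrow> bool" where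
  "kkt_solution f g A B c x y z \<longleftrightarrow>
     A x + B y = c \<and>
     0 \<in> (\<lambda>w. w - adjoint A z) ` subdifferential f x \<and>
     0 \<in> (\<lambda>w. w - adjoint B z) ` subdifferential g y"

definition primal_optimal ::
  "('a::euclidean_space \<Rightarrow> ereal) \<Rightarrow> ('b::euclidean_space \<Rightarrow> ereal) \<Rightarrow>
   ('a \<Rightarrow> 'c::euclidean_space) \<Rightarrow> ('b \<Rightarrow> 'c) \<Rightarrow> 'c \<Rightarrow> 'a \<Rightarrow> 'b \<Rightarrow> bool" where
  "primal_optimal f g A B c xs ys \<longleftrightarrow>
     is_arg_min (\<lambda>(x, y). f x + g y) (\<lambda>(x, y). A x + B y = c) (xs, ys)"

definition lagrangian ::
  "('a::euclidean_space \<Rightarrow> ereal) \<Rightarrow> ('b::euclidean_space \<Rightarrow> ereal) \<Rightarrow>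
   ('a \<Rightarrow> 'c::euclidean_space) \<Rightarrow> ('b \<Rightarrow> 'c) \<Rightarrow> 'c \<Rightarrow> 'a \<Rightarrow> 'b \<Rightarrow> 'c \<Rightarrow> ereal" where
  "lagrangian f g A B c x y z = f x + g y - ereal ((A x + B y - c) \<bullet> z)"

definition dual_function ::
  "('a::euclidean_space \<Rightarrow> ereal) \<Rightarrow> ('b::euclidean_space \<Rightarrow> ereal) \<Rightarrow>
   ('a \<Rightarrow> 'c::euclidean_space) \<Rightarrow> ('b \<Rightarrow> 'c) \<Rightarrow> 'c \<Rightarrow> 'c \<Rightarrow> ereal" where
  "dual_function f g A B c z = (INF (x, y)\<in>UNIV. lagrangian f g A B c x y z)"

definition dual_optimal ::
  "('a::euclidean_space \<Rightarrow> ereal) \<Rightarrow> ('b::euclidean_space \<Rightarrow> ereal) \<Rightarrow>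
   ('a \<Rightarrow> 'c::euclidean_space) \<Rightarrow> ('b \<Rightarrow> 'c) \<Rightarrow> 'c \<Rightarrow> 'c \<Rightarrow> bool" where
  "dual_optimal f g A B c zs \<longleftrightarrow> is_arg_max (dual_function f g A B c) (\<lambda>_. True) zs"

definition aug_lagrangian ::
  "('a::euclidean_space \<Rightarrow> ereal) \<Rightarrow> ('b::euclidean_space \<Rightarrow> ereal) \<Rightarrow>
   ('a \<Rightarrow> 'c::euclidean_space) \<Rightarrow> ('b \<Rightarrow> 'c) \<Rightarrow> 'c \<Rightarrow> real \<Rightarrow> 'a \<Rightarrow> 'b \<Rightarrow> 'c \<Rightarrow> ereal" where
  "aug_lagrangian f g A B c lam x y z =
     lagrangian f g A B c x y z + ereal (lam / 2 * (norm (A x + B y - c))\<^sup>2)"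

text \<open>The input \<open>y 0\<close> need not lie in the domain of \<open>g\<close>. The first step then has to be read
  with the additive constant \<open>g (y k)\<close> dropped, since otherwise its objective is identically
  \<open>\<infinity>\<close> and every point minimises it; replacing \<open>g\<close> by \<open>\<lambda>_. 0\<close> does exactly
  that. For \<open>g (y k)\<close> finite the minimisers are unchanged
  (lemma \<open>is_arg_min_x_step_iff\<close> below). In the second step \<open>f (x (Suc k))\<close> is always
  finite, because \<open>f\<close> is proper.\<close>

definition spadmm_sequence ::
  "('a::euclidean_space \<Rightarrow> ereal) \<Rightarrow> ('b::euclidean_space \<Rightarrow> ereal) \<Rightarrow>
   ('a \<Rightarrow> 'c::euclidean_space) \<Rightarrow> ('b \<Rightarrow> 'c) \<Rightarrow> 'c \<Rightarrow> ('a \<Rightarrow> 'a) \<Rightarrow> ('b \<Rightarrow> 'b) \<Rightarrow> real \<Rightarrow> real \<Rightarrow>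
   (nat \<Rightarrow> 'a) \<Rightarrow> (nat \<Rightarrow> 'b) \<Rightarrow> (nat \<Rightarrow> 'c) \<Rightarrow> bool" where
  "spadmm_sequence f g A B c S T lam \<tau> x y z \<longleftrightarrow>
     (\<forall>k.
        is_arg_min
          (\<lambda>u. aug_lagrangian f (\<lambda>_. 0) A B c lam u (y k) (z k)
               + ereal ((seminorm_op S (u - x k))\<^sup>2 / 2))
          (\<lambda>_. True) (x (Suc k)) \<and>
        is_arg_min
          (\<lambda>v. aug_lagrangian f g A B c lam (x (Suc k)) v (z k)
               + ereal ((seminorm_op T (v - y k))\<^sup>2 / 2))
          (\<lambda>_. True) (y (Suc k)) \<and>
        z (Suc k) = z k - (\<tau> * lam) *\<^sub>R (A (x (Suc k)) + B (y (Suc k)) - c))"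

lemma is_arg_min_x_step_iff:
  fixes f :: "'a::euclidean_space \<Rightarrow> ereal" and g :: "'b::euclidean_space \<Rightarrow> ereal"
    and A :: "'a \<Rightarrow> 'c::euclidean_space"
  assumes "\<bar>g v\<bar> \<noteq> \<infinity>"
  shows "is_arg_min (\<lambda>u. aug_lagrangian f g A B c lam u v w + ereal (h u)) (\<lambda>_. True) x \<longleftrightarrow>
         is_arg_min (\<lambda>u. aug_lagrangian f (\<lambda>_. 0) A B c lam u v w + ereal (h u)) (\<lambda>_. True) x"
proof -
  obtain r where r: "g v = ereal r"
    using assms by auto
  have shift: "aug_lagrangian f g A B c lam u v w + ereal (h u) =
      aug_lagrangian f (\<lambda>_. 0) A B c lam u v w + ereal (h u) + ereal r" for u
    by (cases "f u") (simp_all add: aug_lagrangian_def lagrangian_def r)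
  have "a + ereal r \<le> b + ereal r \<longleftrightarrow> a \<le> b" for a b :: ereal
    by (cases a; cases b) simp_all
  then show ?thesis
    by (simp add: is_arg_min_linorder shift)
qed

end

theory Submission
  imports Defs
begin

text \<open>The method is analysed as a fixed point iteration that is nonexpansive in the energy
  \<open>E(a, b, \<zeta>) = \<parallel>\<zeta>\<parallel>\<^sup>2/(\<tau>\<lambda>) + \<lambda>\<parallel>Bb\<parallel>\<^sup>2 + \<parallel>a\<parallel>\<^sub>S\<^sup>2 + \<parallel>b\<parallel>\<^sub>T\<^sup>2\<close>.  The optimality conditions of the two subproblems
  are inclusions in the subdifferentials of \<open>f\<close> and \<open>g\<close>.  Monotonicity compares them with the KKT
  inclusions at a solution, and equally with the inclusions of the preceding sweep.  Both comparisons
  have the same algebraic form, so one computation (\<open>energy_balance\<close>) yields two facts: the energy of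
  the error \<open>w\<^sub>k - w\<^sup>*\<close> drops by about the energy of the increment \<open>\<Delta>w\<close> to the next iterate
  (\<open>error_energy_balance\<close>), and the energy of the increments never grows
  (\<open>difference_energy_decreasing\<close>).

  Summing the first fact bounds the total increment energy by \<open>C\<close>; by the second, the last of \<open>K\<close>
  increments has at most the average energy, hence energy at most \<open>C/K\<close>.  This is where a rate for
  the last iterate, not just for the best one, comes from.  The drop can fall short of the increment
  energy because of a cross term \<open>\<langle>r, B\<Delta>y\<rangle>\<close>, where \<open>r\<close> is the residual.  For \<open>\<tau> < 1\<close> it is absorbed by completing a square, at the
  price of the factor \<open>1/m\<close> in \<open>C2\<close> (\<open>difference_energy_rate_relaxed\<close>).  For \<open>\<tau> = 1\<close> that factor
  degenerates, but then the cross term telescopes, at the price of the additional term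
  \<open>\<parallel>y\<^sub>0 - y\<^sub>1\<parallel>\<^sub>T\<^sup>2\<close> in \<open>C1\<close> (\<open>difference_energy_rate_unrelaxed\<close>).

  The residual is, up to sign, \<open>1/(\<tau>\<lambda>)\<close> times the multiplier increment, so its bound is immediate.  The objective
  gap is bounded below by \<open>\<langle>r, z\<^sup>*\<rangle>\<close> through the saddle point property, and above by the
  subgradients at the last iterate: their contribution is \<open>\<langle>r, z\<^sup>*\<rangle>\<close>, minus the energy inner product
  of an increment of size \<open>\<surd>(C/K)\<close> with an error of size \<open>\<surd>C\<close>, plus one cross term of order \<open>C/K\<close>
  (\<open>objective_gap_upper\<close>).  Strong duality, which follows from the existence of one KKT point, makes
  the given primal and dual optima a KKT triple (\<open>optimal_pair_kkt\<close>).\<close>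

section \<open>Subgradients and minimisers\<close>

lemma subgradient_finite:
  assumes "closed_proper_convex f" "w \<in> subdifferential f x"
  shows "\<bar>f x\<bar> \<noteq> \<infinity>"
proof -
  obtain u where u: "f u < \<infinity>"
    using assms(1) by (auto simp: closed_proper_convex_def edom_def)
  have "f x + ereal (w \<bullet> (u - x)) \<le> f u"
    using assms(2) by (auto simp: subdifferential_def)
  with u have "f x \<noteq> \<infinity>"
    by auto
  moreover have "f x \<noteq> -\<infinity>"
    using assms(1) by (auto simp: closed_proper_convex_def)
  ultimately show ?thesis
    by auto
qed

lemma subgradient_real_ineq:
  assumes "w \<in> subdifferential f x" "f x = ereal p" "f u = ereal q"
  shows "p + w \<bullet> (u - x) \<le> q"
proof -
  have "f x + ereal (w \<bullet> (u - x)) \<le> f u"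
    using assms(1) by (auto simp: subdifferential_def)
  then show ?thesis
    by (simp add: assms)
qed

lemma subdifferential_monotone:
  assumes "closed_proper_convex f" "w \<in> subdifferential f x" "w' \<in> subdifferential f x'"
  shows "0 \<le> (w - w') \<bullet> (x - x')"
proof -
  obtain p where p: "f x = ereal p"
    using subgradient_finite[OF assms(1,2)] by auto
  obtain q where q: "f x' = ereal q"
    using subgradient_finite[OF assms(1,3)] by auto
  have "p + w \<bullet> (x' - x) \<le> q" "q + w' \<bullet> (x - x') \<le> p"
    using subgradient_real_ineq assms p q by blast+
  then show ?thesis
    by (simp add: algebra_simps)
qed

lemma closed_proper_convex_real_ineq:
  assumes "closed_proper_convex f" "f x = ereal p" "f u = ereal q" "0 \<le> s" "s \<le> 1"
  shows "f (x + s *\<^sub>R (u - x)) \<le> ereal (p + s * (q - p))"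
proof -
  have "convex (ereal_epigraph f)"
    using assms(1) by (simp add: closed_proper_convex_def)
  moreover have "(x, p) \<in> ereal_epigraph f" "(u, q) \<in> ereal_epigraph f"
    using assms by (auto simp: ereal_epigraph_def)
  ultimately have "(1 - s) *\<^sub>R (x, p) + s *\<^sub>R (u, q) \<in> ereal_epigraph f"
    using assms by (intro convexD) auto
  moreover have "(1 - s) *\<^sub>R (x, p) + s *\<^sub>R (u, q) = (x + s *\<^sub>R (u - x), p + s * (q - p))"
    by (simp add: algebra_simps)
  ultimately show ?thesis
    by (simp add: ereal_epigraph_def)
qed

lemma minimiser_finite:
  assumes "closed_proper_convex f"
    and "is_arg_min (\<lambda>u. f u + ereal (q u)) (\<lambda>_. True) x"
  shows "\<bar>f x\<bar> \<noteq> \<infinity>"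
proof -
  obtain u where u: "f u < \<infinity>"
    using assms(1) by (auto simp: closed_proper_convex_def edom_def)
  have "f x + ereal (q x) \<le> f u + ereal (q u)"
    using assms(2) by (simp add: is_arg_min_linorder)
  with u have "f x \<noteq> \<infinity>"
    by auto
  moreover have "f x \<noteq> -\<infinity>"
    using assms(1) by (auto simp: closed_proper_convex_def)
  ultimately show ?thesis
    by auto
qed

text \<open>Fermat's rule for a convex function plus a quadratic with gradient \<open>p\<close> at the minimiser:
  moving a fraction \<open>s\<close> towards \<open>u\<close> changes \<open>f\<close> by at most \<open>s\<close> times the full increment and the
  quadratic by its linear part up to \<open>s\<^sup>2\<close>, so dividing by \<open>s\<close> and letting \<open>s\<close> tend to \<open>0\<close> leaves
  the subgradient inequality.\<close>

lemma minimiser_subgradient: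
  fixes f :: "'a::euclidean_space \<Rightarrow> ereal"
  assumes f: "closed_proper_convex f"
    and min: "is_arg_min (\<lambda>u. f u + ereal (q u)) (\<lambda>_. True) x"
    and quad: "\<And>s d. q (x + s *\<^sub>R d) = q x + s * (p \<bullet> d) + s\<^sup>2 * h d"
  shows "- p \<in> subdifferential f x"
  unfolding subdifferential_def
proof (intro CollectI allI)
  fix u
  obtain a where a: "f x = ereal a"
    using minimiser_finite[OF f min] by auto
  show "f x + ereal ((- p) \<bullet> (u - x)) \<le> f u"
  proof (cases "f u")
    case (real b)
    define d where "d = u - x"
    have "0 \<le> b - a + p \<bullet> d + s * h d" if s: "0 < s" "s < 1" for s
    proof -
      have "f x + ereal (q x) \<le> f (x + s *\<^sub>R d) + ereal (q (x + s *\<^sub>R d))"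
        using min by (simp add: is_arg_min_linorder)
      also have "\<dots> \<le> ereal (a + s * (b - a)) + ereal (q (x + s *\<^sub>R d))"
        unfolding d_def using s closed_proper_convex_real_ineq[OF f a real]
        by (intro add_right_mono) auto
      finally have "0 \<le> s * (b - a + p \<bullet> d + s * h d)"
        by (simp add: a quad algebra_simps power2_eq_square)
      then show ?thesis
        using s by (simp add: zero_le_mult_iff)
    qed
    then have "eventually (\<lambda>s. 0 \<le> b - a + p \<bullet> d + s * h d) (at_right 0)"
      by (auto simp: eventually_at_right_field intro!: exI[of _ 1])
    moreover have "((\<lambda>s. b - a + p \<bullet> d + s * h d) \<longlongrightarrow> b - a + p \<bullet> d + 0 * h d) (at_right 0)"
      by (intro tendsto_intros)
    ultimately have "0 \<le> b - a + p \<bullet> d + 0 * h d"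
      by (intro tendsto_lowerbound) auto
    then show ?thesis
      by (simp add: a real d_def)
  next
    case PInf
    then show ?thesis by simp
  next
    case MInf
    then show ?thesis
      using f by (simp add: closed_proper_convex_def)
  qed
qed

lemma inner_adjoint_left:
  fixes A :: "'a::euclidean_space \<Rightarrow> 'b::euclidean_space"
  shows "linear A \<Longrightarrow> adjoint A \<zeta> \<bullet> v = A v \<bullet> \<zeta>"
  unfolding inner_commute[of "adjoint A \<zeta>"] by (rule adjoint_works)

lemma inner_adjoint_diff:
  fixes A :: "'a::euclidean_space \<Rightarrow> 'b::euclidean_space"
  shows "linear A \<Longrightarrow> (adjoint A \<zeta> - w) \<bullet> v = A v \<bullet> \<zeta> - v \<bullet> w"
  by (simp only: inner_adjoint_left inner_diff_left inner_commute[of w])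

lemma pos_semidef_linear: "pos_semidef S \<Longrightarrow> linear S"
  by (simp add: pos_semidef_def self_adjoint_def)

lemma pos_semidef_nonneg: "pos_semidef S \<Longrightarrow> 0 \<le> v \<bullet> S v"
  by (simp add: pos_semidef_def)

lemma pos_semidef_commute:
  assumes "pos_semidef S"
  shows "u \<bullet> S v = v \<bullet> S u"
proof -
  have "u \<bullet> adjoint S v = S u \<bullet> v"
    using adjoint_works[OF pos_semidef_linear[OF assms]] .
  then show ?thesis
    using assms by (simp add: pos_semidef_def self_adjoint_def inner_commute)
qed

lemma seminorm_op_power2:
  "pos_semidef S \<Longrightarrow> (seminorm_op S v)\<^sup>2 = v \<bullet> S v"
  by (simp add: seminorm_op_def pos_semidef_nonneg)

text \<open>Both subproblems of the method have this shape: a convex function plus a linear term, a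
  squared residual and a proximal term.\<close>

lemma proximal_penalty_minimiser_subgradient:
  fixes f :: "'a::euclidean_space \<Rightarrow> ereal" and A :: "'a \<Rightarrow> 'c::euclidean_space"
  assumes f: "closed_proper_convex f" and A: "linear A" and S: "pos_semidef S"
    and min: "is_arg_min (\<lambda>u. f u + ereal (\<kappa> - (A u + b) \<bullet> \<zeta> + lam / 2 * (norm (A u + b))\<^sup>2
                + (seminorm_op S (u - v))\<^sup>2 / 2)) (\<lambda>_. True) x"
  shows "adjoint A (\<zeta> - lam *\<^sub>R (A x + b)) - S (x - v) \<in> subdifferential f x"
proof -
  define p where "p = S (x - v) - adjoint A (\<zeta> - lam *\<^sub>R (A x + b))"
  note lin = linear_add[OF A] linear_scale[OF A]
    linear_add[OF pos_semidef_linear[OF S]] linear_scale[OF pos_semidef_linear[OF S]]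
  have "- p \<in> subdifferential f x"
  proof (rule minimiser_subgradient[OF f min])
    fix s d
    have p: "p \<bullet> d = d \<bullet> S (x - v) - A d \<bullet> \<zeta> + lam * (A d \<bullet> (A x + b))"
      using inner_adjoint_diff[OF A, of "\<zeta> - lam *\<^sub>R (A x + b)" "S (x - v)" d]
      by (simp add: p_def inner_diff_left inner_diff_right)
    have "A (x + s *\<^sub>R d) + b = (A x + b) + s *\<^sub>R A d"
      by (simp add: lin)
    then have lin_part: "(A (x + s *\<^sub>R d) + b) \<bullet> \<zeta> = (A x + b) \<bullet> \<zeta> + s * (A d \<bullet> \<zeta>)"
      and penalty: "(norm (A (x + s *\<^sub>R d) + b))\<^sup>2
        = (norm (A x + b))\<^sup>2 + 2 * s * (A d \<bullet> (A x + b)) + s\<^sup>2 * (norm (A d))\<^sup>2"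
      unfolding power2_norm_eq_inner
      by (simp_all only: inner_add_left[of _ "s *\<^sub>R A d"]
          inner_add_right[of _ _ "s *\<^sub>R A d"] inner_scaleR_left inner_scaleR_right
          inner_commute[of "A x + b" "A d"])
        (simp add: power2_eq_square algebra_simps)
    have "x + s *\<^sub>R d - v = (x - v) + s *\<^sub>R d"
      by simp
    then have prox: "(seminorm_op S (x + s *\<^sub>R d - v))\<^sup>2
        = (seminorm_op S (x - v))\<^sup>2 + 2 * s * (d \<bullet> S (x - v)) + s\<^sup>2 * (d \<bullet> S d)"
      unfolding seminorm_op_power2[OF S]
      by (simp only: lin inner_add_left[of _ "s *\<^sub>R d"]
          inner_add_right[of _ _ "s *\<^sub>R S d"] inner_scaleR_left inner_scaleR_right
          pos_semidef_commute[OF S, of "x - v" d])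
        (simp add: power2_eq_square algebra_simps)
    have "\<kappa> - (i0 + s * i1) + lam / 2 * (n0 + 2 * s * n1 + s\<^sup>2 * n2) + (q0 + 2 * s * q1 + s\<^sup>2 * q2) / 2
        = \<kappa> - i0 + lam / 2 * n0 + q0 / 2 + s * (q1 - i1 + lam * n1) + s\<^sup>2 * (lam / 2 * n2 + q2 / 2)"
      for i0 i1 n0 n1 n2 q0 q1 q2 :: real
      by (simp add: field_simps)
    then show "\<kappa> - (A (x + s *\<^sub>R d) + b) \<bullet> \<zeta> + lam / 2 * (norm (A (x + s *\<^sub>R d) + b))\<^sup>2
            + (seminorm_op S (x + s *\<^sub>R d - v))\<^sup>2 / 2
        = \<kappa> - (A x + b) \<bullet> \<zeta> + lam / 2 * (norm (A x + b))\<^sup>2 + (seminorm_op S (x - v))\<^sup>2 / 2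
          + s * (p \<bullet> d) + s\<^sup>2 * (lam / 2 * (norm (A d))\<^sup>2 + d \<bullet> S d / 2)"
      unfolding p lin_part penalty prox .
  qed
  then show ?thesis
    by (simp add: p_def)
qed

section \<open>The energy along an sPADMM run\<close>

locale spadmm_run =
  fixes f :: "'a::euclidean_space \<Rightarrow> ereal" and g :: "'b::euclidean_space \<Rightarrow> ereal"
    and A :: "'a \<Rightarrow> 'c::euclidean_space" and B :: "'b \<Rightarrow> 'c" and c :: 'c
    and S :: "'a \<Rightarrow> 'a" and T :: "'b \<Rightarrow> 'b" and lam \<tau> :: real
    and x :: "nat \<Rightarrow> 'a" and y :: "nat \<Rightarrow> 'b" and z :: "nat \<Rightarrow> 'c"
  assumes f: "closed_proper_convex f" and g: "closed_proper_convex g"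
    and A: "linear A" and B: "linear B"
    and lam: "0 < lam" and tau_pos: "0 < \<tau>" and tau_le: "\<tau> \<le> 1"
    and S: "pos_semidef S" and T: "pos_semidef T"
    and run: "spadmm_sequence f g A B c S T lam \<tau> x y z"
begin

definition energy_form :: "'a \<times> 'b \<times> 'c \<Rightarrow> 'a \<times> 'b \<times> 'c \<Rightarrow> real" where
  "energy_form = (\<lambda>(a, b, \<zeta>) (a', b', \<zeta>').
     \<zeta> \<bullet> \<zeta>' / (\<tau> * lam) + lam * (B b \<bullet> B b') + a \<bullet> S a' + b \<bullet> T b')"

abbreviation energy :: "'a \<times> 'b \<times> 'c \<Rightarrow> real" where
  "energy w \<equiv> energy_form w w"

definition iterate :: "nat \<Rightarrow> 'a \<times> 'b \<times> 'c" where
  "iterate k = (x k, y k, z k)"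

definition residual :: "nat \<Rightarrow> 'c" where
  "residual k = A (x k) + B (y k) - c"

lemmas lin_simps = linear_add[OF A] linear_diff[OF A] linear_add[OF B] linear_diff[OF B]
  linear_scale[OF B]
  linear_add[OF pos_semidef_linear[OF S]] linear_diff[OF pos_semidef_linear[OF S]]
  linear_scale[OF pos_semidef_linear[OF S]]
  linear_add[OF pos_semidef_linear[OF T]] linear_diff[OF pos_semidef_linear[OF T]]
  linear_scale[OF pos_semidef_linear[OF T]]

lemmas adjoint_diff = linear_diff[OF adjoint_linear[OF A]] linear_diff[OF adjoint_linear[OF B]]

lemma multiplier_step: "z (Suc k) = z k - (\<tau> * lam) *\<^sub>R residual (Suc k)"
  using run by (simp add: spadmm_sequence_def residual_def)

text \<open>The \<open>x\<close>-step sees the old \<open>y k\<close>, so its subgradient contains a residual that mixes two sweeps.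
  The \<open>y\<close>-step below involves the true residual.  This asymmetry is the source of the
  \<open>\<lambda>\<parallel>Bb\<parallel>\<^sup>2\<close> term in the energy.\<close>

lemma x_step_subgradient:
  "adjoint A (z k - lam *\<^sub>R (A (x (Suc k)) + B (y k) - c)) - S (x (Suc k) - x k)
     \<in> subdifferential f (x (Suc k))"
proof -
  have "is_arg_min (\<lambda>u. aug_lagrangian f (\<lambda>_. 0) A B c lam u (y k) (z k)
          + ereal ((seminorm_op S (u - x k))\<^sup>2 / 2)) (\<lambda>_. True) (x (Suc k))"
    using run by (simp add: spadmm_sequence_def)
  moreover have "aug_lagrangian f (\<lambda>_. 0) A B c lam u (y k) (z k)
          + ereal ((seminorm_op S (u - x k))\<^sup>2 / 2)
      = f u + ereal (0 - (A u + (B (y k) - c)) \<bullet> z k + lam / 2 * (norm (A u + (B (y k) - c)))\<^sup>2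
                + (seminorm_op S (u - x k))\<^sup>2 / 2)" for u
    by (cases "f u") (simp_all add: aug_lagrangian_def lagrangian_def add_diff_eq)
  ultimately have "is_arg_min (\<lambda>u. f u + ereal (0 - (A u + (B (y k) - c)) \<bullet> z k
      + lam / 2 * (norm (A u + (B (y k) - c)))\<^sup>2 + (seminorm_op S (u - x k))\<^sup>2 / 2))
      (\<lambda>_. True) (x (Suc k))"
    by simp
  from proximal_penalty_minimiser_subgradient[OF f A S this] show ?thesis
    by (simp only: add_diff_eq)
qed

lemma y_step_subgradient:
  "adjoint B (z k - lam *\<^sub>R residual (Suc k)) - T (y (Suc k) - y k)
     \<in> subdifferential g (y (Suc k))"
proof -
  \<comment> \<open>The objective of the \<open>y\<close>-step carries the additive constant \<open>f (x (Suc k))\<close>.\<close>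
  obtain p where p: "f (x (Suc k)) = ereal p"
    using subgradient_finite[OF f x_step_subgradient] by auto
  have "is_arg_min (\<lambda>v. aug_lagrangian f g A B c lam (x (Suc k)) v (z k)
          + ereal ((seminorm_op T (v - y k))\<^sup>2 / 2)) (\<lambda>_. True) (y (Suc k))"
    using run by (simp add: spadmm_sequence_def)
  moreover have "aug_lagrangian f g A B c lam (x (Suc k)) v (z k)
          + ereal ((seminorm_op T (v - y k))\<^sup>2 / 2)
      = g v + ereal (p - (B v + (A (x (Suc k)) - c)) \<bullet> z k
                + lam / 2 * (norm (B v + (A (x (Suc k)) - c)))\<^sup>2
                + (seminorm_op T (v - y k))\<^sup>2 / 2)" for v
  proof -
    have rearrange: "A (x (Suc k)) + B v - c = B v + (A (x (Suc k)) - c)"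
      by simp
    show ?thesis
      unfolding aug_lagrangian_def lagrangian_def rearrange by (cases "g v") (simp_all add: p)
  qed
  ultimately have "is_arg_min (\<lambda>v. g v + ereal (p - (B v + (A (x (Suc k)) - c)) \<bullet> z k
      + lam / 2 * (norm (B v + (A (x (Suc k)) - c)))\<^sup>2 + (seminorm_op T (v - y k))\<^sup>2 / 2))
      (\<lambda>_. True) (y (Suc k))"
    by simp
  moreover have "residual (Suc k) = B (y (Suc k)) + (A (x (Suc k)) - c)"
    by (simp add: residual_def)
  ultimately show ?thesis
    using proximal_penalty_minimiser_subgradient[OF g B T] by (simp only:)
qed

lemma energy_nonneg: "0 \<le> energy w"
  using lam tau_pos pos_semidef_nonneg[OF S] pos_semidef_nonneg[OF T]
  by (simp add: energy_form_def split: prod.split)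

lemma energy_form_commute: "energy_form u v = energy_form v u"
proof -
  obtain a b \<zeta> a' b' \<zeta>' where uv: "u = (a, b, \<zeta>)" "v = (a', b', \<zeta>')"
    by (metis prod_cases3)
  show ?thesis
    by (simp only: uv energy_form_def prod.case inner_commute[of \<zeta> \<zeta>']
        inner_commute[of "B b" "B b'"] pos_semidef_commute[OF S, of a a']
        pos_semidef_commute[OF T, of b b'])
qed

lemma energy_form_diff_left: "energy_form (u - v) w = energy_form u w - energy_form v w"
  by (simp add: energy_form_def lin_simps inner_diff_left diff_divide_distrib right_diff_distrib
      split: prod.split)

lemma energy_diff: "energy (u - v) = energy u - 2 * energy_form v u + energy v"
  using energy_form_diff_left[of u v "u - v"] energy_form_diff_left[of u v u]
    energy_form_diff_left[of u v v] energy_form_commute[of u v]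
    energy_form_commute[of u "u - v"] energy_form_commute[of v "u - v"]
  by linarith

lemma energy_scaleR: "energy (s *\<^sub>R v) = s\<^sup>2 * energy v" "energy_form (s *\<^sub>R v) u = s * energy_form v u"
  by (auto simp: energy_form_def lin_simps power2_eq_square algebra_simps split: prod.split)

lemma energy_form_weighted_bound:
  assumes "0 < s"
  shows "- energy_form v u \<le> (s * energy v + energy u / s) / 2"
proof -
  have "0 \<le> energy u + 2 * s * energy_form v u + s\<^sup>2 * energy v"
    using energy_nonneg[of "u - (- s) *\<^sub>R v"]
    unfolding energy_diff energy_scaleR(1)[of "- s" v] energy_scaleR(2)[of "- s" v u] by simp
  then show ?thesis
    using assms by (simp add: field_simps power2_eq_square)
qed

lemma residual_energy_bound:
  "\<tau> * lam * (norm (residual (Suc k)))\<^sup>2 + lam * (norm (B (y (Suc k) - y k)))\<^sup>2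
     \<le> energy (iterate (Suc k) - iterate k)"
  using pos_semidef_nonneg[OF S, of "x (Suc k) - x k"] pos_semidef_nonneg[OF T, of "y (Suc k) - y k"]
    lam tau_pos
  by (simp add: energy_form_def iterate_def multiplier_step power2_norm_eq_inner)

text \<open>The two optimality conditions of one sweep, tested against the new point \<open>(a, b)\<close>, add up to
  a statement about inner products of increments with new values.  The polarisation identity
  \<open>2\<langle>u - u', u\<rangle> = \<parallel>u\<parallel>\<^sup>2 - \<parallel>u'\<parallel>\<^sup>2 + \<parallel>u - u'\<parallel>\<^sup>2\<close>, applied to each block, converts it into an energy
  balance.  What does not fit is the term coming from the stale \<open>b'\<close> in the first condition and from
  the relaxation factor.  The lemma is stated for abstract vectors because it is applied both to
  the errors and to the successive differences of the iterates.\<close>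

lemma energy_balance:
  fixes a a' :: 'a and b b' :: 'b and \<zeta> :: 'c
  defines "r \<equiv> A a + B b"
  assumes 1: "0 \<le> (adjoint A (\<zeta> - lam *\<^sub>R (A a + B b')) - S (a - a')) \<bullet> a"
    and 2: "0 \<le> (adjoint B (\<zeta> - lam *\<^sub>R r) - T (b - b')) \<bullet> b"
  defines "w \<equiv> (a, b, \<zeta> - (\<tau> * lam) *\<^sub>R r)" and "w' \<equiv> (a', b', \<zeta>)"
  shows "energy w + energy (w - w') + 2 * lam * ((1 - \<tau>) * (r \<bullet> r) - B (b - b') \<bullet> r) \<le> energy w'"
proof -
  have 3: "0 \<le> A a \<bullet> (\<zeta> - lam *\<^sub>R (A a + B b')) - a \<bullet> S (a - a')"
    using 1 by (simp only: inner_adjoint_diff[OF A])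
  have 4: "0 \<le> B b \<bullet> (\<zeta> - lam *\<^sub>R r) - b \<bullet> T (b - b')"
    using 2 by (simp only: inner_adjoint_diff[OF B])
  have S_polar: "2 * (a \<bullet> S (a - a')) = a \<bullet> S a + (a - a') \<bullet> S (a - a') - a' \<bullet> S a'"
    using pos_semidef_commute[OF S, of a a']
    by (simp add: lin_simps inner_diff_left inner_diff_right)
  have T_polar: "2 * (b \<bullet> T (b - b')) = b \<bullet> T b + (b - b') \<bullet> T (b - b') - b' \<bullet> T b'"
    using pos_semidef_commute[OF T, of b b']
    by (simp add: lin_simps inner_diff_left inner_diff_right)
  have B_polar: "lam * (B b \<bullet> B b + B (b - b') \<bullet> B (b - b') - B b' \<bullet> B b')
      = 2 * lam * (B b \<bullet> B (b - b'))"
    by (simp add: lin_simps inner_diff_left inner_diff_right inner_commute)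
  have multiplier: "(\<zeta> - (\<tau> * lam) *\<^sub>R r) \<bullet> (\<zeta> - (\<tau> * lam) *\<^sub>R r) / (\<tau> * lam)
      + (\<tau> * lam) *\<^sub>R r \<bullet> (\<tau> * lam) *\<^sub>R r / (\<tau> * lam)
      = \<zeta> \<bullet> \<zeta> / (\<tau> * lam) - 2 * (\<zeta> \<bullet> r) + 2 * lam * (\<tau> * (r \<bullet> r))"
  proof -
    have "(\<zeta> - e *\<^sub>R r) \<bullet> (\<zeta> - e *\<^sub>R r) / e + e *\<^sub>R r \<bullet> e *\<^sub>R r / e
        = \<zeta> \<bullet> \<zeta> / e - 2 * (\<zeta> \<bullet> r) + 2 * e * (r \<bullet> r)" if "0 < e" for e
      using that by (simp add: inner_diff_left inner_diff_right inner_commute field_simps)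
    from this[of "\<tau> * lam"] show ?thesis
      using lam tau_pos by (simp add: mult_ac)
  qed
  have cross: "A a \<bullet> (\<zeta> - lam *\<^sub>R (A a + B b')) + B b \<bullet> (\<zeta> - lam *\<^sub>R r)
      = \<zeta> \<bullet> r - lam * (r \<bullet> r) + lam * (B (b - b') \<bullet> r) - lam * (B b \<bullet> B (b - b'))"
    unfolding r_def by (simp add: lin_simps inner_diff_left inner_diff_right inner_add_left
        inner_add_right inner_commute algebra_simps)
  have e: "energy w - energy w' = (\<zeta> - (\<tau> * lam) *\<^sub>R r) \<bullet> (\<zeta> - (\<tau> * lam) *\<^sub>R r) / (\<tau> * lam)
      - \<zeta> \<bullet> \<zeta> / (\<tau> * lam) + lam * (B b \<bullet> B b) - lam * (B b' \<bullet> B b')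
      + a \<bullet> S a - a' \<bullet> S a' + b \<bullet> T b - b' \<bullet> T b'"
    unfolding w_def w'_def energy_form_def by simp
  have d: "energy (w - w') = (\<tau> * lam) *\<^sub>R r \<bullet> (\<tau> * lam) *\<^sub>R r / (\<tau> * lam)
      + lam * (B (b - b') \<bullet> B (b - b')) + (a - a') \<bullet> S (a - a') + (b - b') \<bullet> T (b - b')"
    unfolding w_def w'_def energy_form_def by simp
  have distr: "lam * (p + q - o') = lam * p + lam * q - lam * o'"
    "lam * ((1 - \<tau>) * p - q) = lam * p - lam * (\<tau> * p) - lam * q"
    for p q o' :: real
    by (simp_all add: algebra_simps)
  show ?thesis
    using 3 4 e d multiplier cross S_polar T_polar B_polar unfolding distr mult.assoc by argo
qed

lemma error_energy_balance:
  assumes "kkt_solution f g A B c xs ys zs"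
  defines "ws \<equiv> (xs, ys, zs)"
  shows "energy (iterate (Suc k) - ws) + energy (iterate (Suc k) - iterate k)
     + 2 * lam * ((1 - \<tau>) * (residual (Suc k) \<bullet> residual (Suc k))
                  - B (y (Suc k) - y k) \<bullet> residual (Suc k)) \<le> energy (iterate k - ws)"
proof -
  let ?a = "x (Suc k) - xs" and ?a' = "x k - xs" and ?b = "y (Suc k) - ys" and ?b' = "y k - ys"
  let ?\<zeta> = "z k - zs"
  have feas: "A xs + B ys = c" and xs: "adjoint A zs \<in> subdifferential f xs"
    and ys: "adjoint B zs \<in> subdifferential g ys"
    using assms(1) by (auto simp: kkt_solution_def)
  have r: "residual (Suc k) = A ?a + B ?b"
    using feas by (auto simp: residual_def lin_simps)
  have stale: "A (x (Suc k)) + B (y k) - c = A ?a + B ?b'"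
    using feas by (auto simp: lin_simps)
  have x_opt: "0 \<le> (adjoint A (?\<zeta> - lam *\<^sub>R (A ?a + B ?b')) - S (?a - ?a')) \<bullet> ?a"
  proof -
    have *: "?\<zeta> - lam *\<^sub>R (A ?a + B ?b')
        = (z k - lam *\<^sub>R (A (x (Suc k)) + B (y k) - c)) - zs"
      unfolding stale by simp
    show ?thesis
      using subdifferential_monotone[OF f x_step_subgradient[of k] xs]
      unfolding * adjoint_diff by (simp add: algebra_simps)
  qed
  have y_opt: "0 \<le> (adjoint B (?\<zeta> - lam *\<^sub>R (A ?a + B ?b)) - T (?b - ?b')) \<bullet> ?b"
  proof -
    have *: "?\<zeta> - lam *\<^sub>R (A ?a + B ?b) = (z k - lam *\<^sub>R residual (Suc k)) - zs"
      unfolding r by simp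
    show ?thesis
      using subdifferential_monotone[OF g y_step_subgradient[of k] ys]
      unfolding * adjoint_diff by (simp add: algebra_simps)
  qed
  have mult: "?\<zeta> - (\<tau> * lam) *\<^sub>R (A ?a + B ?b) = z (Suc k) - zs"
    by (simp add: multiplier_step r)
  show ?thesis
    using energy_balance[OF x_opt y_opt] unfolding mult by (simp add: ws_def iterate_def r)
qed

lemma difference_energy_balance:
  fixes k :: nat
  defines "q \<equiv> residual (Suc (Suc k)) - residual (Suc k)"
  shows "energy (iterate (Suc (Suc k)) - iterate (Suc k))
     + energy ((iterate (Suc (Suc k)) - iterate (Suc k)) - (iterate (Suc k) - iterate k))
     + 2 * lam * ((1 - \<tau>) * (q \<bullet> q)
                  - B ((y (Suc (Suc k)) - y (Suc k)) - (y (Suc k) - y k)) \<bullet> q)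
     \<le> energy (iterate (Suc k) - iterate k)"
proof -
  let ?a = "x (Suc (Suc k)) - x (Suc k)" and ?a' = "x (Suc k) - x k"
  let ?b = "y (Suc (Suc k)) - y (Suc k)" and ?b' = "y (Suc k) - y k"
  let ?\<zeta> = "z (Suc k) - z k"
  have r: "A ?a + B ?b = q"
    by (simp add: q_def residual_def lin_simps)
  have "0 \<le> (adjoint A (?\<zeta> - lam *\<^sub>R (A ?a + B ?b')) - S (?a - ?a')) \<bullet> ?a"
  proof -
    have *: "?\<zeta> - lam *\<^sub>R (A ?a + B ?b')
      = (z (Suc k) - lam *\<^sub>R (A (x (Suc (Suc k))) + B (y (Suc k)) - c))
        - (z k - lam *\<^sub>R (A (x (Suc k)) + B (y k) - c))"
      by (simp add: lin_simps algebra_simps)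
    show ?thesis
      using subdifferential_monotone[OF f x_step_subgradient[of "Suc k"] x_step_subgradient[of k]]
      unfolding * adjoint_diff by (simp add: lin_simps algebra_simps)
  qed
  moreover have "0 \<le> (adjoint B (?\<zeta> - lam *\<^sub>R (A ?a + B ?b)) - T (?b - ?b')) \<bullet> ?b"
  proof -
    have *: "?\<zeta> - lam *\<^sub>R (A ?a + B ?b)
      = (z (Suc k) - lam *\<^sub>R residual (Suc (Suc k))) - (z k - lam *\<^sub>R residual (Suc k))"
      unfolding r by (simp add: q_def algebra_simps)
    show ?thesis
      using subdifferential_monotone[OF g y_step_subgradient[of "Suc k"] y_step_subgradient[of k]]
      unfolding * adjoint_diff by (simp add: lin_simps algebra_simps)
  qed
  moreover have "?\<zeta> - (\<tau> * lam) *\<^sub>R q = z (Suc (Suc k)) - z (Suc k)"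
    by (simp add: q_def multiplier_step[of "Suc k"] multiplier_step[of k] algebra_simps)
  ultimately show ?thesis
    using energy_balance[of ?\<zeta> ?a ?b' ?a' ?b]
    by (simp add: r iterate_def)
qed

text \<open>The excess term of the energy balance has no sign.  The part of the increment energy that is
  visible in the residual and in \<open>B\<Delta>y\<close> completes it to a square.\<close>

lemma excess_nonneg:
  assumes "\<tau> * lam * (r \<bullet> r) + lam * (q \<bullet> q) \<le> E"
  shows "0 \<le> E + 2 * lam * ((1 - \<tau>) * (r \<bullet> r) - q \<bullet> r)"
proof -
  have "0 \<le> (1 - \<tau>) * (r \<bullet> r) + (r - q) \<bullet> (r - q)"
    using tau_le by simp
  then have "0 \<le> lam * ((1 - \<tau>) * (r \<bullet> r) + (r - q) \<bullet> (r - q))"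
    using lam by simp
  also have "\<dots> = \<tau> * lam * (r \<bullet> r) + lam * (q \<bullet> q) + 2 * lam * ((1 - \<tau>) * (r \<bullet> r) - q \<bullet> r)"
    by (simp add: inner_diff_left inner_diff_right inner_commute[of r q] algebra_simps)
  finally show ?thesis
    using assms by linarith
qed

lemma error_energy_decreasing:
  assumes "kkt_solution f g A B c xs ys zs"
  shows "energy (iterate (Suc k) - (xs, ys, zs)) \<le> energy (iterate k - (xs, ys, zs))"
  using error_energy_balance[OF assms, of k]
    excess_nonneg[OF residual_energy_bound[of k, unfolded power2_norm_eq_inner]]
  by linarith

lemma error_energy_le_initial:
  assumes "kkt_solution f g A B c xs ys zs" "1 \<le> k"
  shows "energy (iterate k - (xs, ys, zs)) \<le> energy (iterate 1 - (xs, ys, zs))"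
  using assms(2) by (induction k rule: dec_induct)
    (auto intro: order_trans[OF error_energy_decreasing[OF assms(1)]])

lemma difference_energy_decreasing:
  "energy (iterate (Suc (Suc k)) - iterate (Suc k)) \<le> energy (iterate (Suc k) - iterate k)"
proof -
  let ?q = "residual (Suc (Suc k)) - residual (Suc k)"
  let ?a = "(x (Suc (Suc k)) - x (Suc k)) - (x (Suc k) - x k)"
  let ?b = "(y (Suc (Suc k)) - y (Suc k)) - (y (Suc k) - y k)"
  have z: "(z (Suc (Suc k)) - z (Suc k)) - (z (Suc k) - z k) = (\<tau> * lam) *\<^sub>R (- ?q)"
    by (simp add: multiplier_step[of "Suc k"] multiplier_step[of k] algebra_simps)
  have "\<tau> * lam * (?q \<bullet> ?q) + lam * (B ?b \<bullet> B ?b)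
      \<le> energy ((iterate (Suc (Suc k)) - iterate (Suc k)) - (iterate (Suc k) - iterate k))"
    unfolding iterate_def energy_form_def diff_Pair prod.case z
    using pos_semidef_nonneg[OF S, of ?a] pos_semidef_nonneg[OF T, of ?b] lam tau_pos
    by (simp only: inner_scaleR_left inner_scaleR_right inner_minus_left inner_minus_right) simp
  from excess_nonneg[OF this] difference_energy_balance[of k] show ?thesis
    by linarith
qed

text \<open>With the multiplier update, the optimality conditions of two consecutive \<open>y\<close>-steps give
  \<open>\<lambda>\<langle>(1 - \<tau>)r' - r, B\<Delta>y\<rangle> \<ge> \<langle>T(\<Delta>y - \<Delta>y'), \<Delta>y\<rangle>\<close>, where primes mark the preceding sweep.
  At \<open>\<tau> = 1\<close> the older residual cancels, and the cross term telescopes.\<close>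

lemma cross_term_telescopes:
  assumes "\<tau> = 1"
  shows "2 * lam * (B (y (Suc (Suc k)) - y (Suc k)) \<bullet> residual (Suc (Suc k)))
    \<le> (y (Suc k) - y k) \<bullet> T (y (Suc k) - y k)
       - (y (Suc (Suc k)) - y (Suc k)) \<bullet> T (y (Suc (Suc k)) - y (Suc k))"
proof -
  let ?b = "y (Suc (Suc k)) - y (Suc k)" and ?b' = "y (Suc k) - y k"
  let ?r = "residual (Suc (Suc k))"
  have eq: "z (Suc k) - lam *\<^sub>R ?r - (z k - lam *\<^sub>R residual (Suc k)) = - lam *\<^sub>R ?r"
    by (simp add: assms multiplier_step[of k])
  have "adjoint B u - T b - (adjoint B v - T b') = adjoint B (u - v) - T (b - b')" for u v b b'
    by (simp add: adjoint_diff lin_simps)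
  then have "0 \<le> (adjoint B (- lam *\<^sub>R ?r) - T (?b - ?b')) \<bullet> ?b"
    using subdifferential_monotone[OF g y_step_subgradient[of "Suc k"] y_step_subgradient[of k]]
    unfolding eq[symmetric] by simp
  then have "lam * (B ?b \<bullet> ?r) \<le> - (?b \<bullet> T (?b - ?b'))"
    unfolding inner_adjoint_diff[OF B] by simp
  also have "- (?b \<bullet> T (?b - ?b')) \<le> (?b' \<bullet> T ?b' - ?b \<bullet> T ?b) / 2"
    using pos_semidef_nonneg[OF T, of "?b - ?b'"] pos_semidef_commute[OF T, of ?b ?b']
    by (simp add: linear_diff[OF pos_semidef_linear[OF T], of ?b ?b']
        inner_diff_left[of ?b ?b'] inner_diff_right[of _ "T ?b" "T ?b'"])
  finally show ?thesis
    by simp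
qed

text \<open>The increment energies sum to at most \<open>P 1 / m\<close> and do not increase, so the last one is at most
  their average.  Clearing denominators keeps the degenerate case \<open>m = 0\<close> meaningful.\<close>

lemma last_difference_energy_bound:
  assumes m: "0 \<le> m"
    and step: "\<And>k. 1 \<le> k \<Longrightarrow> P (Suc k) + m * energy (iterate (Suc k) - iterate k) \<le> P k"
    and P: "\<And>k. 0 \<le> (P k :: real)"
  shows "m * real K * energy (iterate (Suc K) - iterate K) \<le> P 1"
proof -
  have "P (Suc K) + m * real K * energy (iterate (Suc K) - iterate K) \<le> P 1"
  proof (induction K)
    case 0
    then show ?case by simp
  next
    case (Suc K)
    let ?e = "energy (iterate (Suc (Suc K)) - iterate (Suc K))"
    have "m * real K * ?e \<le> m * real K * energy (iterate (Suc K) - iterate K)"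
      using m by (intro mult_left_mono difference_energy_decreasing) auto
    then show ?case
      using Suc.IH step[of "Suc K"] by (simp add: algebra_simps)
  qed
  then show ?thesis
    using P[of "Suc K"] by linarith
qed

text \<open>The residual and \<open>B\<Delta>y\<close> parts of the increment energy, together with the excess term, form a
  quadratic form in the variables \<open>\<surd>(\<tau>\<lambda>) r\<close> and \<open>\<surd>\<lambda> B\<Delta>y\<close>, definite for \<open>\<tau> < 1\<close>.  The constant \<open>m\<close> is
  its smallest eigenvalue: subtracting it leaves a perfect square.\<close>

lemma difference_energy_rate_relaxed:
  assumes kkt: "kkt_solution f g A B c xs ys zs"
    and m: "m = (1 - sqrt (\<tau>\<^sup>2 - \<tau> + 1)) / \<tau>"
  shows "m * real K * energy (iterate (Suc K) - iterate K) \<le> energy (iterate 1 - (xs, ys, zs))"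
proof -
  define s where "s = sqrt (\<tau>\<^sup>2 - \<tau> + 1)"
  have m: "m = (1 - s) / \<tau>"
    using m by (simp add: s_def)
  have sq: "s\<^sup>2 = \<tau>\<^sup>2 - \<tau> + 1" "0 < s"
  proof -
    have "0 < \<tau>\<^sup>2 - \<tau> + 1"
      using tau_le zero_less_power[OF tau_pos, of 2] by linarith
    then show "s\<^sup>2 = \<tau>\<^sup>2 - \<tau> + 1" "0 < s"
      by (simp_all add: s_def)
  qed
  have le: "s \<le> 1"
    unfolding s_def using tau_pos tau_le by (simp add: power2_eq_square)
  have m0: "0 \<le> m"
    using le tau_pos by (simp add: m)
  have "1 - \<tau> \<le> s"
    by (rule power2_le_imp_le) (use tau_pos sq in \<open>auto simp: power2_eq_square algebra_simps\<close>)
  then have m1: "m \<le> 1"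
    using tau_pos by (simp add: m)
  \<comment> \<open>Up to the factor \<open>\<lambda>\<close>, what is left after subtracting \<open>m\<close> is
      \<open>\<alpha>\<parallel>r\<parallel>\<^sup>2 - 2\<langle>B\<Delta>y, r\<rangle> + (1 - m)\<parallel>B\<Delta>y\<parallel>\<^sup>2\<close>; it is a square because \<open>\<alpha>(1 - m) = 1\<close>.\<close>
  define \<alpha> where "\<alpha> = 1 - \<tau> + s"
  have \<alpha>: "0 < \<alpha>" "\<alpha> = 2 - \<tau> - m * \<tau>"
    using tau_pos tau_le sq(2) m by (simp_all add: \<alpha>_def)
  have "\<alpha> * (1 - m) = (s\<^sup>2 - (1 - \<tau>)\<^sup>2) / \<tau>"
    using tau_pos by (simp add: \<alpha>_def m power2_eq_square field_simps)
  also have "\<dots> = 1"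
    unfolding sq(1) using tau_pos by (simp add: power2_eq_square field_simps)
  finally have \<alpha>m: "\<alpha> * (1 - m) = 1" .
  show ?thesis
  proof (rule last_difference_energy_bound[OF m0, where P = "\<lambda>k. energy (iterate k - (xs, ys, zs))"])
    fix k
    let ?r = "residual (Suc k)" and ?q = "B (y (Suc k) - y k)"
    let ?e = "energy (iterate (Suc k) - iterate k)"
    have "0 \<le> (\<alpha> *\<^sub>R ?r - ?q) \<bullet> (\<alpha> *\<^sub>R ?r - ?q) / \<alpha>"
      using \<alpha>(1) by simp
    also have "\<dots> = \<alpha> * (?r \<bullet> ?r) - 2 * (?q \<bullet> ?r) + (1 - m) * (?q \<bullet> ?q)"
    proof -
      have "1 - m = 1 / \<alpha>"
        using \<alpha>m \<alpha>(1) by (simp add: field_simps)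
      show ?thesis
        unfolding \<open>1 - m = 1 / \<alpha>\<close> using \<alpha>(1) by (simp add: inner_diff_left inner_diff_right inner_commute[of ?r ?q] field_simps)
    qed
    finally have "0 \<le> lam * (\<alpha> * (?r \<bullet> ?r) - 2 * (?q \<bullet> ?r) + (1 - m) * (?q \<bullet> ?q))"
      using lam by simp
    also have "\<dots> = (1 - m) * (\<tau> * lam * (?r \<bullet> ?r) + lam * (?q \<bullet> ?q))
        + 2 * lam * ((1 - \<tau>) * (?r \<bullet> ?r) - ?q \<bullet> ?r)"
      unfolding \<alpha>(2) by (simp add: algebra_simps)
    also have "\<dots> \<le> (1 - m) * ?e + 2 * lam * ((1 - \<tau>) * (?r \<bullet> ?r) - ?q \<bullet> ?r)"
      using m1 residual_energy_bound[of k, unfolded power2_norm_eq_inner]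
      by (intro add_right_mono mult_left_mono) auto
    finally show "energy (iterate (Suc k) - (xs, ys, zs)) + m * ?e
        \<le> energy (iterate k - (xs, ys, zs))"
      using error_energy_balance[OF kkt, of k] by (simp add: algebra_simps)
  qed (rule energy_nonneg)
qed

lemma difference_energy_rate_unrelaxed:
  assumes kkt: "kkt_solution f g A B c xs ys zs" and "\<tau> = 1"
  shows "real K * energy (iterate (Suc K) - iterate K)
    \<le> energy (iterate 1 - (xs, ys, zs)) + (y 1 - y 0) \<bullet> T (y 1 - y 0)"
proof -
  \<comment> \<open>The extra term makes the telescoping cross term part of the potential.  It involves the
      preceding iterate, so the sum starts at \<open>1\<close>.\<close>
  define P where "P k = energy (iterate k - (xs, ys, zs))
    + (y k - y (k - 1)) \<bullet> T (y k - y (k - 1))" for k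
  have "1 * real K * energy (iterate (Suc K) - iterate K) \<le> P 1"
  proof (rule last_difference_energy_bound)
    fix k :: nat
    assume "1 \<le> k"
    then obtain j where "k = Suc j"
      by (cases k) auto
    then show "P (Suc k) + 1 * energy (iterate (Suc k) - iterate k) \<le> P k"
      using error_energy_balance[OF kkt, of k] cross_term_telescopes[OF assms(2), of j]
      by (simp add: P_def assms(2))
  qed (auto simp: P_def intro!: add_nonneg_nonneg energy_nonneg pos_semidef_nonneg[OF T])
  then show ?thesis
    by (simp add: P_def)
qed

section \<open>Residual and objective bounds\<close>

lemma residual_norm_bound:
  assumes "energy (iterate (Suc k) - iterate k) \<le> C / K"
  shows "norm (residual (Suc k)) \<le> sqrt (C / (\<tau> * lam * K))"
proof (rule real_le_rsqrt)
  have "\<tau> * lam * (norm (residual (Suc k)))\<^sup>2 \<le> C / K"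
    using residual_energy_bound[of k] assms lam
    by (smt (verit) mult_nonneg_nonneg zero_le_power2)
  then show "(norm (residual (Suc k)))\<^sup>2 \<le> C / (\<tau> * lam * K)"
    using lam tau_pos by (simp add: pos_le_divide_eq mult.commute flip: divide_divide_eq_left)
qed

text \<open>The saddle point inequality of the Lagrangian at \<open>zs\<close>.\<close>

lemma objective_gap_lower:
  assumes kkt: "kkt_solution f g A B c xs ys zs"
    and "f (x (Suc k)) = ereal p" "g (y (Suc k)) = ereal q" "f xs = ereal ps" "g ys = ereal qs"
  shows "residual (Suc k) \<bullet> zs \<le> p + q - ps - qs"
proof -
  have feas: "A xs + B ys = c" and xs: "adjoint A zs \<in> subdifferential f xs"
    and ys: "adjoint B zs \<in> subdifferential g ys"
    using kkt by (auto simp: kkt_solution_def)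
  have "ps + adjoint A zs \<bullet> (x (Suc k) - xs) \<le> p" "qs + adjoint B zs \<bullet> (y (Suc k) - ys) \<le> q"
    using subgradient_real_ineq[OF xs] subgradient_real_ineq[OF ys] assms by auto
  then show ?thesis
    unfolding inner_adjoint_left[OF A] inner_adjoint_left[OF B] residual_def
    by (simp add: lin_simps inner_diff_left inner_add_left flip: feas)
qed

text \<open>The subgradients produced by the two steps bound the objective gap by exactly the bilinear
  energy form between the last increment and the current error, up to the multiplier term and one
  stale cross term.  Here \<open>\<tau> \<le> 1\<close> makes the leftover multiple of \<open>\<parallel>r\<parallel>\<^sup>2\<close> nonpositive.\<close>

lemma objective_gap_upper:
  assumes kkt: "kkt_solution f g A B c xs ys zs"
    and "f (x (Suc k)) = ereal p" "g (y (Suc k)) = ereal q" "f xs = ereal ps" "g ys = ereal qs"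
  shows "p + q - ps - qs \<le> residual (Suc k) \<bullet> zs
    - energy_form (iterate (Suc k) - iterate k) (iterate (Suc k) - (xs, ys, zs))
    + lam * (B (y (Suc k) - y k) \<bullet> residual (Suc k))"
proof -
  let ?a = "x (Suc k) - xs" and ?b = "y (Suc k) - ys"
  let ?da = "x (Suc k) - x k" and ?db = "y (Suc k) - y k"
  let ?r = "residual (Suc k)"
  have feas: "A xs + B ys = c"
    using kkt by (auto simp: kkt_solution_def)
  have r: "?r = A ?a + B ?b"
    using feas by (auto simp: residual_def lin_simps)
  have stale: "A (x (Suc k)) + B (y k) - c = ?r - B ?db"
    by (simp add: residual_def lin_simps)
  have "p + (adjoint A (z k - lam *\<^sub>R (?r - B ?db)) - S ?da) \<bullet> (xs - x (Suc k)) \<le> ps"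
    using subgradient_real_ineq[OF x_step_subgradient] assms by (simp flip: stale)
  then have "p - ps \<le> (adjoint A (z k - lam *\<^sub>R (?r - B ?db)) - S ?da) \<bullet> ?a"
    by (simp add: inner_diff_right)
  moreover have "q + (adjoint B (z k - lam *\<^sub>R ?r) - T ?db) \<bullet> (ys - y (Suc k)) \<le> qs"
    using subgradient_real_ineq[OF y_step_subgradient] assms by simp
  then have "q - qs \<le> (adjoint B (z k - lam *\<^sub>R ?r) - T ?db) \<bullet> ?b"
    by (simp add: inner_diff_right)
  ultimately have "p + q - ps - qs \<le> A ?a \<bullet> (z k - lam *\<^sub>R (?r - B ?db)) - ?a \<bullet> S ?da
      + B ?b \<bullet> (z k - lam *\<^sub>R ?r) - ?b \<bullet> T ?db"
    unfolding inner_adjoint_diff[OF A] inner_adjoint_diff[OF B] by linarith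
  also have "\<dots> = ?r \<bullet> (z k - lam *\<^sub>R ?r) + lam * (A ?a \<bullet> B ?db) - ?a \<bullet> S ?da - ?b \<bullet> T ?db"
    unfolding r inner_add_left inner_diff_right inner_scaleR_right by (simp add: algebra_simps)
  also have "A ?a = ?r - B ?b"
    using r by simp
  also have "?r \<bullet> (z k - lam *\<^sub>R ?r) + lam * ((?r - B ?b) \<bullet> B ?db) - ?a \<bullet> S ?da - ?b \<bullet> T ?db
      = ?r \<bullet> zs - energy_form (iterate (Suc k) - iterate k) (iterate (Suc k) - (xs, ys, zs))
        + lam * (B ?db \<bullet> ?r) - (1 - \<tau>) * lam * (?r \<bullet> ?r)"
  proof -
    have "z (Suc k) - z k = (\<tau> * lam) *\<^sub>R (- ?r)"
      by (simp add: multiplier_step)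
    then have "energy_form (iterate (Suc k) - iterate k) (iterate (Suc k) - (xs, ys, zs))
        = - (?r \<bullet> (z (Suc k) - zs)) + lam * (B ?db \<bullet> B ?b) + ?a \<bullet> S ?da + ?b \<bullet> T ?db"
      using lam tau_pos pos_semidef_commute[OF S, of ?da ?a] pos_semidef_commute[OF T, of ?db ?b]
      by (simp add: energy_form_def iterate_def)
    then show ?thesis
      by (simp add: multiplier_step inner_diff_right inner_diff_left inner_commute
          algebra_simps)
  qed
  also have "\<dots> \<le> ?r \<bullet> zs
      - energy_form (iterate (Suc k) - iterate k) (iterate (Suc k) - (xs, ys, zs))
      + lam * (B ?db \<bullet> ?r)"
    using tau_le lam by simp
  finally show ?thesis .
qed

lemma objective_gap_rate:
  assumes kkt: "kkt_solution f g A B c xs ys zs"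
    and fin: "f (x (Suc k)) = ereal p" "g (y (Suc k)) = ereal q" "f xs = ereal ps" "g ys = ereal qs"
    and K: "0 < K"
    and err: "energy (iterate (Suc k) - (xs, ys, zs)) \<le> C"
    and inc: "energy (iterate (Suc k) - iterate k) \<le> C / K"
  shows "p + q - ps - qs \<le> residual (Suc k) \<bullet> zs + C / sqrt K + C / (2 * K * sqrt \<tau>)"
proof -
  let ?r = "residual (Suc k)" and ?q = "B (y (Suc k) - y k)"
  \<comment> \<open>The weight \<open>\<surd>K\<close> balances an increment energy of order \<open>1/K\<close> against a bounded error energy.\<close>
  have "- energy_form (iterate (Suc k) - iterate k) (iterate (Suc k) - (xs, ys, zs))
      \<le> (sqrt K * energy (iterate (Suc k) - iterate k)
          + energy (iterate (Suc k) - (xs, ys, zs)) / sqrt K) / 2"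
    using K by (intro energy_form_weighted_bound) simp
  also have "\<dots> \<le> (sqrt K * (C / K) + C / sqrt K) / 2"
    using err inc K by (intro divide_right_mono add_mono mult_left_mono) auto
  also have "sqrt K * (C / K) = C / sqrt K"
    using K by (simp add: field_simps flip: real_sqrt_mult)
  finally have 1: "- energy_form (iterate (Suc k) - iterate k) (iterate (Suc k) - (xs, ys, zs))
      \<le> C / sqrt K" by simp
  have st: "sqrt \<tau> * sqrt \<tau> = \<tau>" "0 < sqrt \<tau>"
    using tau_pos by auto
  have "0 \<le> (sqrt \<tau> *\<^sub>R ?r - ?q) \<bullet> (sqrt \<tau> *\<^sub>R ?r - ?q)"
    by simp
  also have "\<dots> = \<tau> * (?r \<bullet> ?r) - 2 * sqrt \<tau> * (?q \<bullet> ?r) + ?q \<bullet> ?q"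
  proof -
    have "(e *\<^sub>R ?r - ?q) \<bullet> (e *\<^sub>R ?r - ?q) = (e * e) * (?r \<bullet> ?r) - 2 * e * (?q \<bullet> ?r) + ?q \<bullet> ?q" for e
      by (simp add: inner_diff_left inner_diff_right inner_commute[of ?r ?q] algebra_simps)
    from this[of "sqrt \<tau>"] show ?thesis
      by (simp only: st(1))
  qed
  finally have "0 \<le> lam * (\<tau> * (?r \<bullet> ?r) - 2 * sqrt \<tau> * (?q \<bullet> ?r) + ?q \<bullet> ?q)"
    using lam by simp
  then have "2 * sqrt \<tau> * (lam * (?q \<bullet> ?r)) \<le> C / K"
    using residual_energy_bound[of k] inc by (simp add: power2_norm_eq_inner algebra_simps)
  then have 2: "lam * (?q \<bullet> ?r) \<le> C / (2 * K * sqrt \<tau>)"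
    using K st(2) by (simp add: field_simps)
  show ?thesis
    using objective_gap_upper[OF kkt fin] 1 2 by linarith
qed

end

section \<open>Strong duality\<close>

lemma dual_function_le:
  "dual_function f g A B c \<zeta> \<le> lagrangian f g A B c u v \<zeta>"
  unfolding dual_function_def by (rule INF_lower2[of "(u, v)"]) auto

text \<open>A single KKT point closes the duality gap, and then any primal optimum pairs with any dual
  optimum: the Lagrangian at the dual optimum is bounded below by the optimal value, which is
  attained at the primal optimum, and minimality in each block separately is the KKT inclusion.\<close>

lemma optimal_pair_kkt:
  fixes A :: "'a::euclidean_space \<Rightarrow> 'c::euclidean_space" and B :: "'b::euclidean_space \<Rightarrow> 'c"
  assumes f: "closed_proper_convex f" and g: "closed_proper_convex g"
    and A: "linear A" and B: "linear B"
    and kkt: "kkt_solution f g A B c x' y' z'"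
    and primal: "primal_optimal f g A B c xs ys"
    and dual: "dual_optimal f g A B c zs"
  shows "kkt_solution f g A B c xs ys zs"
proof -
  have feas': "A x' + B y' = c" and x': "adjoint A z' \<in> subdifferential f x'"
    and y': "adjoint B z' \<in> subdifferential g y'"
    using kkt by (auto simp: kkt_solution_def)
  obtain p' q' where pq': "f x' = ereal p'" "g y' = ereal q'"
    using subgradient_finite[OF f x'] subgradient_finite[OF g y'] by auto
  have feas: "A xs + B ys = c" and "f xs + g ys \<le> f x' + g y'"
    using primal feas' by (auto simp: primal_optimal_def is_arg_min_linorder)
  then have le: "f xs + g ys \<le> ereal (p' + q')"
    by (simp add: pq')
  moreover have "f xs \<noteq> -\<infinity>" "g ys \<noteq> -\<infinity>"
    using f g by (auto simp: closed_proper_convex_def)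
  ultimately obtain ps qs where pqs: "f xs = ereal ps" "g ys = ereal qs"
    by (cases "f xs"; cases "g ys") auto
  have "ereal (p' + q') \<le> lagrangian f g A B c u v z'" for u v
  proof -
    have "f x' + ereal (adjoint A z' \<bullet> (u - x')) \<le> f u"
      "g y' + ereal (adjoint B z' \<bullet> (v - y')) \<le> g v"
      using x' y' by (auto simp: subdifferential_def)
    moreover have "adjoint A z' \<bullet> (u - x') = A u \<bullet> z' - A x' \<bullet> z'"
      "adjoint B z' \<bullet> (v - y') = B v \<bullet> z' - B y' \<bullet> z'"
      by (simp_all add: inner_adjoint_left A B linear_diff[OF A] linear_diff[OF B] inner_diff_left
          inner_diff_right)
    ultimately show ?thesis
      by (cases "f u"; cases "g v")
        (auto simp: pq' lagrangian_def inner_diff_left inner_add_left simp flip: feas')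
  qed
  then have "ereal (p' + q') \<le> dual_function f g A B c z'"
    unfolding dual_function_def by (auto intro!: INF_greatest)
  also have "\<dots> \<le> dual_function f g A B c zs"
    using dual by (auto simp: dual_optimal_def is_arg_max_linorder)
  finally have "f xs + g ys \<le> dual_function f g A B c zs"
    by (rule order_trans[OF le])
  then have saddle: "ereal (ps + qs) \<le> lagrangian f g A B c u v zs" for u v
    using order_trans[OF _ dual_function_le] by (fastforce simp: pqs)
  have "adjoint A zs \<in> subdifferential f xs"
    unfolding subdifferential_def
  proof (intro CollectI allI)
    fix u
    have "A u + B ys - c = A (u - xs)"
      by (simp add: linear_diff[OF A] flip: feas)
    then show "f xs + ereal (adjoint A zs \<bullet> (u - xs)) \<le> f u"
      using saddle[of u ys]
      by (cases "f u") (auto simp: lagrangian_def pqs inner_adjoint_left[OF A])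
  qed
  moreover have "adjoint B zs \<in> subdifferential g ys"
    unfolding subdifferential_def
  proof (intro CollectI allI)
    fix v
    have "A xs + B v - c = B (v - ys)"
      by (simp add: linear_diff[OF B] flip: feas)
    then show "g ys + ereal (adjoint B zs \<bullet> (v - ys)) \<le> g v"
      using saddle[of xs v]
      by (cases "g v") (auto simp: lagrangian_def pqs inner_adjoint_left[OF B])
  qed
  ultimately show ?thesis
    using feas by (auto simp: kkt_solution_def image_iff)
qed

section \<open>The convergence rate\<close>

theorem theorem1:
  fixes f :: "'a::euclidean_space \<Rightarrow> ereal" and g :: "'b::euclidean_space \<Rightarrow> ereal"
    and A :: "'a \<Rightarrow> 'c::euclidean_space" and B :: "'b \<Rightarrow> 'c" and c :: 'c
    and \<Sigma>f S :: "'a \<Rightarrow> 'a" and \<Sigma>g T :: "'b \<Rightarrow> 'b"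
    and lam \<tau> t m C1 C2 C :: real
    and x :: "nat \<Rightarrow> 'a" and y :: "nat \<Rightarrow> 'b" and z :: "nat \<Rightarrow> 'c"
    and xs :: 'a and ys :: 'b and zs :: 'c
  assumes "closed_proper_convex f" and "closed_proper_convex g"
    and "linear A" and "linear B"
    and "curvature_op f \<Sigma>f" and "curvature_op g \<Sigma>g"
    and "\<exists>x' y' z'. kkt_solution f g A B c x' y' z'"
    and "lam > 0" and "0 < \<tau>" and "\<tau> \<le> 1"
    and "pos_semidef S" and "pos_semidef T"
    and "pos_def (\<lambda>u. \<Sigma>f u + S u + lam *\<^sub>R adjoint A (A u))"
    and "pos_def (\<lambda>v. \<Sigma>g v + T v + lam *\<^sub>R adjoint B (B v))"
    and "spadmm_sequence f g A B c S T lam \<tau> x y z"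
    and "primal_optimal f g A B c xs ys"
    and "dual_optimal f g A B c zs"
    and "t = (\<tau> - 1 - sqrt (\<tau>\<^sup>2 - \<tau> + 1)) / (2 * \<tau>\<^sup>2 * lam)"
    and "m = 2 * \<tau> * lam * t - (\<tau> - 2) / \<tau>"
    and "C1 = 1 / lam * (norm (z 1 - zs))\<^sup>2 + lam * (norm (B (y 1 - ys)))\<^sup>2
              + (seminorm_op S (x 1 - xs))\<^sup>2 + (seminorm_op T (y 1 - ys))\<^sup>2
              + (seminorm_op T (y 0 - y 1))\<^sup>2"
    \<comment> \<open>For \<open>\<tau> = 1\<close> one has \<open>m = 0\<close>; then \<open>C2 = 0\<close> since \<open>1 / 0 = 0\<close>,
        hence \<open>C = C1\<close>, which is the strongest reading of the bounds in that case.\<close>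
    and "C2 = 1 / m * (1 / (\<tau> * lam) * (norm (z 1 - zs))\<^sup>2 + lam * (norm (B (y 1 - ys)))\<^sup>2
              + (seminorm_op S (x 1 - xs))\<^sup>2 + (seminorm_op T (y 1 - ys))\<^sup>2)"
    and "C = max C1 C2"
  shows "0 \<le> C \<and>
    (\<forall>K\<ge>1.
       ereal (- norm zs * sqrt (C / (\<tau> * lam * real K)))
         \<le> f (x (K + 1)) + g (y (K + 1)) - f xs - g ys \<and>
       f (x (K + 1)) + g (y (K + 1)) - f xs - g ys
         \<le> ereal (norm zs * sqrt (C / (\<tau> * lam * real K)) + 4 * C / sqrt (real K)
                  + C / (real K * sqrt \<tau>)) \<and>
       0 \<le> norm (A (x (K + 1)) + B (y (K + 1)) - c) \<and>
       norm (A (x (K + 1)) + B (y (K + 1)) - c) = 1 / (\<tau> * lam) * norm (z (K + 1) - z K) \<and>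
       norm (A (x (K + 1)) + B (y (K + 1)) - c) \<le> sqrt (C / (\<tau> * lam * real K)))"
proof -
  obtain x' y' z' where "kkt_solution f g A B c x' y' z'"
    using assms(7) by blast
  then have kkt: "kkt_solution f g A B c xs ys zs"
    using optimal_pair_kkt assms by blast
  interpret spadmm_run f g A B c S T lam \<tau> x y z
    by (rule spadmm_run.intro; fact assms)
  let ?ws = "(xs, ys, zs)"
  define D where "D = energy (iterate 1 - ?ws)"
  have D0: "0 \<le> D"
    by (simp add: D_def energy_nonneg)
  have D: "D = 1 / (\<tau> * lam) * (norm (z 1 - zs))\<^sup>2 + lam * (norm (B (y 1 - ys)))\<^sup>2
              + (seminorm_op S (x 1 - xs))\<^sup>2 + (seminorm_op T (y 1 - ys))\<^sup>2"
    by (simp add: D_def energy_form_def iterate_def seminorm_op_power2[OF S]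
        seminorm_op_power2[OF T] power2_norm_eq_inner)
  have C1: "0 \<le> C1"
    using assms(20) lam by simp
  have m: "m = (1 - sqrt (\<tau>\<^sup>2 - \<tau> + 1)) / \<tau>"
    unfolding assms(18,19) using lam tau_pos by (simp add: field_simps power2_eq_square)
  have C2: "C2 = D / m"
    unfolding assms(21) D by simp
  have C0: "0 \<le> C"
    using C1 assms(22) by simp
  \<comment> \<open>\<open>C1\<close> serves the case \<open>\<tau> = 1\<close> and \<open>C2\<close> the case \<open>\<tau> < 1\<close>; in the latter \<open>0 < m \<le> 1\<close>, so \<open>C2\<close> also
      dominates the initial error energy \<open>D\<close>.\<close>
  have bounds: "D \<le> C \<and> energy (iterate (Suc K) - iterate K) \<le> C / real K" if "1 \<le> K" for K
  proof (cases "\<tau> = 1")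
    case True
    have eq: "C1 = D + (y 1 - y 0) \<bullet> T (y 1 - y 0)"
    proof -
      have "(seminorm_op T (y 0 - y 1))\<^sup>2 = (y 1 - y 0) \<bullet> T (y 1 - y 0)"
        unfolding seminorm_op_power2[OF T] linear_diff[OF pos_semidef_linear[OF T]]
        by (simp add: algebra_simps)
      then show ?thesis
        unfolding assms(20) D True by simp
    qed
    then have "D + (y 1 - y 0) \<bullet> T (y 1 - y 0) \<le> C"
      using assms(22) by simp
    then show ?thesis
      using difference_energy_rate_unrelaxed[OF kkt True, of K] that
        pos_semidef_nonneg[OF T, of "y 1 - y 0"]
      by (auto simp: D_def pos_le_divide_eq mult.commute)
  next
    case False
    then have lt: "\<tau>\<^sup>2 - \<tau> + 1 < 1"
      using tau_le tau_pos by (simp add: power2_eq_square)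
    then have m0: "0 < m"
      using tau_pos by (simp add: m)
    have "1 - \<tau> \<le> sqrt (\<tau>\<^sup>2 - \<tau> + 1)"
      by (rule real_le_rsqrt) (use tau_pos in \<open>simp add: power2_eq_square algebra_simps\<close>)
    then have "m \<le> 1"
      using tau_pos by (simp add: m)
    have DC: "D / m \<le> C"
      using C2 assms(22) by simp
    have "D \<le> D / m"
      using D0 m0 \<open>m \<le> 1\<close> by (simp add: pos_le_divide_eq mult_left_le)
    moreover have "real K * energy (iterate (Suc K) - iterate K) \<le> D / m"
      using difference_energy_rate_relaxed[OF kkt m, of K] m0
      by (simp add: D_def pos_le_divide_eq mult_ac)
    ultimately show ?thesis
      using DC that by (auto simp: pos_le_divide_eq mult.commute)
  qed
  show ?thesis
  proof (intro conjI C0 allI impI)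
    fix K :: nat
    assume K: "1 \<le> K"
    let ?r = "residual (Suc K)" and ?b = "sqrt (C / (\<tau> * lam * real K))"
    have inc: "energy (iterate (Suc K) - iterate K) \<le> C / real K"
      using bounds[OF K] by blast
    have err: "energy (iterate (Suc K) - ?ws) \<le> C"
      using error_energy_le_initial[OF kkt, of "Suc K"] bounds[OF K] by (simp add: D_def)
    have r: "norm ?r \<le> ?b"
      by (rule residual_norm_bound[OF inc])
    have res: "A (x (K + 1)) + B (y (K + 1)) - c = ?r"
      by (simp add: residual_def)
    obtain p q where pq: "f (x (Suc K)) = ereal p" "g (y (Suc K)) = ereal q"
      using subgradient_finite[OF f x_step_subgradient[of K]]
        subgradient_finite[OF g y_step_subgradient[of K]] by auto
    obtain ps qs where pqs: "f xs = ereal ps" "g ys = ereal qs"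
      using kkt subgradient_finite[OF f, of _ xs] subgradient_finite[OF g, of _ ys]
      by (fastforce simp: kkt_solution_def)
    have gap: "f (x (K + 1)) + g (y (K + 1)) - f xs - g ys = ereal (p + q - ps - qs)"
      by (simp add: pq pqs)
    have inner: "\<bar>?r \<bullet> zs\<bar> \<le> norm zs * ?b"
      using Cauchy_Schwarz_ineq2[of ?r zs] mult_left_mono[OF r norm_ge_zero[of zs]]
      by (simp add: mult.commute)
    show "ereal (- norm zs * ?b) \<le> f (x (K + 1)) + g (y (K + 1)) - f xs - g ys"
      unfolding gap using inner objective_gap_lower[OF kkt pq pqs] by simp
    have "C / sqrt K \<le> 4 * C / sqrt K" "C / (2 * K * sqrt \<tau>) \<le> C / (K * sqrt \<tau>)"
      using C0 K tau_pos by (auto intro!: divide_right_mono divide_left_mono)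
    then show "f (x (K + 1)) + g (y (K + 1)) - f xs - g ys
        \<le> ereal (norm zs * ?b + 4 * C / sqrt (real K) + C / (real K * sqrt \<tau>))"
      unfolding gap using inner objective_gap_rate[OF kkt pq pqs _ err inc] K by simp
    show "0 \<le> norm (A (x (K + 1)) + B (y (K + 1)) - c)"
      by simp
    show "norm (A (x (K + 1)) + B (y (K + 1)) - c) = 1 / (\<tau> * lam) * norm (z (K + 1) - z K)"
      unfolding res using lam tau_pos by (simp add: multiplier_step)
    show "norm (A (x (K + 1)) + B (y (K + 1)) - c) \<le> ?b"
      unfolding res by (rule r)
  qed
qed

end
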